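(* Let $n$ be a positive integer with $n\equiv 2$ or $3\pmod 4$. Then the equation $$x^2+y^4+z^4-2xy^2-2xz^2-2y^2z^2=n$$ has no integer solutions $(x,y,z)$. *)

theory Defs
  imports "HOL-Number_Theory.Cong"
begin

end

theory Submission
  imports Defs
begin

theorem theorem12:
  fixes n :: int
  assumes "n > 0"
    and "[n = 2] (mod 4) \<or> [n = 3] (mod 4)"
  shows "\<not> (\<exists>x y z :: int.
    x^2 + y^4 + z^4 - 2 * x * y^2 - 2 * x * z^2 - 2 * y^2 * z^2 = n)"
proof
  assume "\<exists>x y z :: int.
    x^2 + y^4 + z^4 - 2 * x * y^2 - 2 * x * z^2 - 2 * y^2 * z^2 = n"
  then obtain x y z :: int where
    n: "x^2 + y^4 + z^4 - 2 * x * y^2 - 2 * x * z^2 - 2 * y^2 * z^2 = n"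
    by blast
  define w where "w = x - y^2 - z^2"
  \<comment> \<open>Completing the square leaves only a multiple of 4, so \<open>n\<close> is a square modulo 4,
    hence congruent to 0 or 1.\<close>
  have "n = w^2 - 4 * (y^2 * z^2)"
    unfolding n [symmetric] w_def by algebra
  then have "n mod 4 = w^2 mod 4"
    by (simp add: mod_eq_dvd_iff)
  moreover have "w^2 mod 4 = 0 \<or> w^2 mod 4 = 1"
  proof (cases "even w")
    case True
    then show ?thesis by (auto elim!: evenE simp: power2_eq_square)
  next
    case False
    then obtain k where "w = 2 * k + 1" by (auto elim: oddE)
    then have "w^2 = 1 + 4 * (k^2 + k)" by algebra
    then show ?thesis by presburger
  qed
  ultimately show False
    using assms(2) by (auto simp: cong_def)
qed

end
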